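(* Let $\sigma:A\to A^+$ be an aperiodic substitution on a finite alphabet $A$ (with $X_\sigma$ uncountable). Then $(X_\sigma,T_\sigma)$ has no more than $|A|$ minimal components.
   Context: $A^+$ is the set of nonempty words over $A$; a substitution $\sigma:A\to A^+$ is extended to $A^+$ by concatenation. $L(\sigma)$ is the set of all factors of the words $\sigma^n(a)$, $a\in A$, $n\ge1$. The substitutional dynamical system of $\sigma$ is $(X_\sigma,T_\sigma)$ with $X_\sigma=\{x\in A^{\mathbb Z}:x[-n,n]\in L(\sigma)\text{ for all }n\}$ and $T_\sigma$ the left shift. $\sigma$ is aperiodic if $(X_\sigma,T_\sigma)$ has no periodic points. Standing assumption of the paper: $X_\sigma$ is uncountable. A minimal component is a nonempty closed $T_\sigma$-invariant subset on which every $T_\sigma$-orbit is dense. *)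

theory Defs
  imports "HOL-Analysis.Analysis" "HOL-Library.Sublist"
begin

text \<open>The alphabet is the type \<open>'a\<close>, which the theorem takes to be finite.\<close>

definition substitution :: "('a \<Rightarrow> 'a list) \<Rightarrow> bool" where
  "substitution \<sigma> \<longleftrightarrow> (\<forall>a. \<sigma> a \<noteq> [])"

definition subst_ext :: "('a \<Rightarrow> 'a list) \<Rightarrow> 'a list \<Rightarrow> 'a list" where
  "subst_ext \<sigma> w = concat (map \<sigma> w)"

definition subst_language :: "('a \<Rightarrow> 'a list) \<Rightarrow> 'a list set" where
  "subst_language \<sigma> = {w. \<exists>a n. n \<ge> 1 \<and> sublist w ((subst_ext \<sigma> ^^ n) [a])}"

definition subst_space :: "('a \<Rightarrow> 'a list) \<Rightarrow> (int \<Rightarrow> 'a) set" where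
  "subst_space \<sigma> = {x. \<forall>n::nat. map x [- int n..int n] \<in> subst_language \<sigma>}"

definition left_shift :: "(int \<Rightarrow> 'a) \<Rightarrow> (int \<Rightarrow> 'a)" where
  "left_shift x = (\<lambda>i. x (i + 1))"

definition aperiodic :: "('a \<Rightarrow> 'a list) \<Rightarrow> bool" where
  "aperiodic \<sigma> \<longleftrightarrow> \<not> (\<exists>x \<in> subst_space \<sigma>. \<exists>p\<ge>1. (left_shift ^^ p) x = x)"

definition full_shift_topology :: "(int \<Rightarrow> 'a) topology" where
  "full_shift_topology = product_topology (\<lambda>_. discrete_topology UNIV) UNIV"

definition subst_topology :: "('a \<Rightarrow> 'a list) \<Rightarrow> (int \<Rightarrow> 'a) topology" where
  "subst_topology \<sigma> = subtopology full_shift_topology (subst_space \<sigma>)"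

text \<open>The shift is a homeomorphism, so orbits are two-sided; \<open>\<lambda>i. x (i + k)\<close> is the
  \<open>k\<close>-th (possibly negative) iterate of the shift at \<open>x\<close>.\<close>

definition shift_orbit :: "(int \<Rightarrow> 'a) \<Rightarrow> (int \<Rightarrow> 'a) set" where
  "shift_orbit x = range (\<lambda>k::int. \<lambda>i. x (i + k))"

text \<open>Closedness in \<open>subst_topology \<sigma>\<close> includes \<open>M \<subseteq> subst_space \<sigma>\<close>.\<close>

definition minimal_component :: "('a \<Rightarrow> 'a list) \<Rightarrow> (int \<Rightarrow> 'a) set \<Rightarrow> bool" where
  "minimal_component \<sigma> M \<longleftrightarrow>
     M \<noteq> {} \<and> closedin (subst_topology \<sigma>) M \<and> left_shift ` M = M \<and>
     (\<forall>x\<in>M. subtopology (subst_topology \<sigma>) M closure_of shift_orbit x = M)"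

end

theory Submission imports Defs begin

text \<open>
  Each minimal component \<open>M\<close> is labelled by one letter, and the labelling is injective.
  Call a letter bounded if its images under the powers of \<open>\<sigma>\<close> have bounded length, and growing
  otherwise. For every \<open>n\<close> and every point \<open>x\<close> of the system, some growing letter \<open>c\<close> has its image
  \<open>\<sigma>\<^sup>n(c)\<close> as a factor of \<open>x\<close> (\<open>growing_letter_image_occurs\<close>).
  Two distinct minimal components are disjoint, and by compactness points chosen in them have no
  long factors in common (\<open>minimal_components_common_words\<close>). Given finitely many components,
  take \<open>n\<close> so large that \<open>\<sigma>\<^sup>n(c)\<close> is too long to be such a common factor for any growing \<open>c\<close>; a letter \<open>c\<close>
  with \<open>\<sigma>\<^sup>n(c)\<close> in the chosen point of \<open>M\<close> then determines \<open>M\<close>.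

  The growing letter is found as follows. A long window of \<open>x\<close> is, up to short ends, the image
  \<open>\<sigma>\<^sup>n(v)\<close> of a long word \<open>v\<close> of the language, and it suffices that \<open>v\<close> contains a growing letter.
  So words consisting of bounded letters only must have bounded length
  (\<open>bounded_words_bounded_length\<close>), and this is where aperiodicity enters. Cutting
  \<open>\<sigma>\<^sup>n(a)\<close> into the images of the letters of \<open>\<sigma>(a)\<close> reduces the claim to prefixes and suffixes of the
  words \<open>\<sigma>\<^sup>n(a)\<close>, and suffixes reduce to prefixes by reversing all words. If the prefixes of bounded
  letters were unbounded, following the first growing letter would lead to a cycle
  \<open>\<sigma>\<^sup>p(c) = v c z\<close> with \<open>v\<close> nonempty and all its letters bounded. Iterating gives prefixes
  \<open>\<dots> \<tau>\<^sup>2(v) \<tau>(v) v\<close> with \<open>\<tau> = \<sigma>\<^sup>p\<close>; the words \<open>\<tau>\<^sup>j(v)\<close> have bounded length, hence recur periodically in \<open>j\<close>,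
  so the language contains all powers of one nonempty word, and the system a periodic point.
\<close>

section \<open>Iterates of a substitution\<close>

abbreviation subst_pow :: "('a \<Rightarrow> 'a list) \<Rightarrow> nat \<Rightarrow> 'a list \<Rightarrow> 'a list" where
  "subst_pow \<sigma> n \<equiv> subst_ext \<sigma> ^^ n"

lemma subst_ext_append: "subst_ext \<sigma> (u @ v) = subst_ext \<sigma> u @ subst_ext \<sigma> v"
  by (simp add: subst_ext_def)

lemma subst_pow_append: "subst_pow \<sigma> n (u @ v) = subst_pow \<sigma> n u @ subst_pow \<sigma> n v"
  by (induction n) (simp_all add: subst_ext_append)

lemma subst_pow_Nil [simp]: "subst_pow \<sigma> n [] = []"
  by (induction n) (simp_all add: subst_ext_def)

lemma subst_pow_Cons: "subst_pow \<sigma> n (a # u) = subst_pow \<sigma> n [a] @ subst_pow \<sigma> n u"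
  using subst_pow_append[of n \<sigma> "[a]" u] by simp

lemma subst_pow_concat: "subst_pow \<sigma> n u = concat (map (\<lambda>a. subst_pow \<sigma> n [a]) u)"
proof (induction u)
  case (Cons a u)
  then show ?case using subst_pow_Cons[of n \<sigma> a u] by simp
qed simp

lemma subst_pow_add: "subst_pow \<sigma> (m + n) u = subst_pow \<sigma> m (subst_pow \<sigma> n u)"
  by (simp add: funpow_add)

lemma subst_pow_Suc_letter: "subst_pow \<sigma> (Suc n) [a] = subst_pow \<sigma> n (\<sigma> a)"
  by (simp add: funpow_Suc_right subst_ext_def del: funpow.simps)

lemma length_subst_ext:
  assumes "substitution \<sigma>"
  shows "length u \<le> length (subst_ext \<sigma> u)"
proof (induction u)
  case (Cons a u)
  have "1 \<le> length (\<sigma> a)"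
    using assms by (simp add: substitution_def Suc_leI)
  then show ?case using Cons by (simp add: subst_ext_def)
qed (simp add: subst_ext_def)

lemma length_subst_pow_mono:
  assumes "substitution \<sigma>" "m \<le> n"
  shows "length (subst_pow \<sigma> m u) \<le> length (subst_pow \<sigma> n u)"
  using assms(2)
proof (induction n rule: dec_induct)
  case (step n)
  then show ?case
    using length_subst_ext[OF assms(1), of "subst_pow \<sigma> n u"] by simp
qed simp

lemma length_le_subst_pow:
  assumes "substitution \<sigma>"
  shows "length u \<le> length (subst_pow \<sigma> n u)"
  using length_subst_pow_mono[OF assms, of 0 n u] by simp

lemma length_subst_pow_le:
  assumes "\<And>a. a \<in> set u \<Longrightarrow> length (subst_pow \<sigma> n [a]) \<le> K"
  shows "length (subst_pow \<sigma> n u) \<le> K * length u"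
  using assms
proof (induction u)
  case (Cons a u)
  then have "length (subst_pow \<sigma> n u) \<le> K * length u" "length (subst_pow \<sigma> n [a]) \<le> K"
    by auto
  then show ?case by (simp add: subst_pow_Cons[of n \<sigma> a u])
qed simp

lemma sublist_subst_pow_letter:
  assumes "b \<in> set u"
  shows "sublist (subst_pow \<sigma> n [b]) (subst_pow \<sigma> n u)"
proof -
  obtain p q where "u = p @ [b] @ q"
    using split_list[OF assms] by auto
  then show ?thesis by (metis sublist_def subst_pow_append)
qed

lemma subst_language_sublist:
  "\<lbrakk>w \<in> subst_language \<sigma>; sublist v w\<rbrakk> \<Longrightarrow> v \<in> subst_language \<sigma>"
  unfolding subst_language_def using sublist_order.order.trans by blast


section \<open>Bounded and growing letters\<close>

definition bounded_letter :: "('a \<Rightarrow> 'a list) \<Rightarrow> 'a \<Rightarrow> bool" where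
  "bounded_letter \<sigma> a \<longleftrightarrow> (\<exists>K. \<forall>n. length (subst_pow \<sigma> n [a]) \<le> K)"

abbreviation bounded_word :: "('a \<Rightarrow> 'a list) \<Rightarrow> 'a list \<Rightarrow> bool" where
  "bounded_word \<sigma> w \<equiv> \<forall>a\<in>set w. bounded_letter \<sigma> a"

lemma bounded_letters_uniform:
  fixes \<sigma> :: "'a::finite \<Rightarrow> 'a list"
  obtains K where "\<And>a n. bounded_letter \<sigma> a \<Longrightarrow> length (subst_pow \<sigma> n [a]) \<le> K"
proof -
  have "\<exists>k. \<forall>n. bounded_letter \<sigma> a \<longrightarrow> length (subst_pow \<sigma> n [a]) \<le> k" for a
    unfolding bounded_letter_def by blast
  then obtain k where k: "\<And>a n. bounded_letter \<sigma> a \<Longrightarrow> length (subst_pow \<sigma> n [a]) \<le> k a"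
    by metis
  have "length (subst_pow \<sigma> n [a]) \<le> Max (range k)" if "bounded_letter \<sigma> a" for a n
    by (rule order_trans[OF k[OF that] Max_ge]) auto
  then show thesis using that by blast
qed

lemma bounded_word_subst_pow:
  assumes "bounded_word \<sigma> u"
  shows "bounded_word \<sigma> (subst_pow \<sigma> n u)"
proof
  fix b assume "b \<in> set (subst_pow \<sigma> n u)"
  then obtain a where a: "a \<in> set u" "b \<in> set (subst_pow \<sigma> n [a])"
    by (subst (asm) subst_pow_concat) auto
  obtain K where K: "\<And>m. length (subst_pow \<sigma> m [a]) \<le> K"
    using assms a(1) unfolding bounded_letter_def by auto
  have "length (subst_pow \<sigma> m [b]) \<le> K" for m
    using sublist_length_le[OF sublist_subst_pow_letter[OF a(2), of m \<sigma>]] K[of "m + n"]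
    unfolding subst_pow_add by (rule order_trans)
  then show "bounded_letter \<sigma> b" unfolding bounded_letter_def by blast
qed

text \<open>Passing from \<open>[a]\<close> to \<open>\<sigma>\<^sup>n(a)\<close> only shifts the sequence of iterates, and lengths never decrease,
  so boundedness of the later iterates bounds the earlier ones. In contrapositive form: every
  image of a growing letter contains a growing letter.\<close>
lemma bounded_letter_if_image_bounded:
  fixes \<sigma> :: "'a::finite \<Rightarrow> 'a list"
  assumes "substitution \<sigma>" "bounded_word \<sigma> (subst_pow \<sigma> n [a])"
  shows "bounded_letter \<sigma> a"
proof -
  obtain K where K: "\<And>a n. bounded_letter \<sigma> a \<Longrightarrow> length (subst_pow \<sigma> n [a]) \<le> K"
    using bounded_letters_uniform[of \<sigma>] by blast
  have "length (subst_pow \<sigma> m [a]) \<le> K * length (subst_pow \<sigma> n [a])" for m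
  proof -
    have "length (subst_pow \<sigma> m [a]) \<le> length (subst_pow \<sigma> (m + n) [a])"
      by (rule length_subst_pow_mono[OF assms(1)]) simp
    also have "\<dots> \<le> K * length (subst_pow \<sigma> n [a])"
      unfolding subst_pow_add by (rule length_subst_pow_le) (use K assms(2) in blast)
    finally show ?thesis .
  qed
  then show ?thesis unfolding bounded_letter_def by blast
qed

text \<open>Lengths are nondecreasing in \<open>n\<close>, so one exponent serves all growing letters.\<close>
lemma growing_letters_long:
  fixes \<sigma> :: "'a::finite \<Rightarrow> 'a list"
  assumes "substitution \<sigma>"
  obtains n where "\<And>c. \<not> bounded_letter \<sigma> c \<Longrightarrow> l \<le> length (subst_pow \<sigma> n [c])"
proof -
  have "\<exists>k. l \<le> length (subst_pow \<sigma> k [c])" if "\<not> bounded_letter \<sigma> c" for c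
  proof (rule ccontr)
    assume "\<nexists>k. l \<le> length (subst_pow \<sigma> k [c])"
    then have "\<forall>k. length (subst_pow \<sigma> k [c]) \<le> l" by (simp add: not_le less_imp_le)
    then show False using that unfolding bounded_letter_def by blast
  qed
  then obtain k where k: "\<And>c. \<not> bounded_letter \<sigma> c \<Longrightarrow> l \<le> length (subst_pow \<sigma> (k c) [c])"
    by metis
  have "l \<le> length (subst_pow \<sigma> (Max (range k)) [c])" if "\<not> bounded_letter \<sigma> c" for c
    by (rule order_trans[OF k[OF that] length_subst_pow_mono[OF assms]]) simp
  then show thesis using that by blast
qed

text \<open>The iterates of all bounded letters together take finitely many values, so two of them
  coincide. Treating all letters at once yields a preperiod and a period that do not depend on the word.\<close>
lemma subst_pow_eventually_periodic:
  fixes \<sigma> :: "'a::finite \<Rightarrow> 'a list"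
  shows "\<exists>i d. d \<ge> 1 \<and> (\<forall>j\<ge>i. \<forall>k u. bounded_word \<sigma> u \<longrightarrow>
    subst_pow \<sigma> (j + k * d) u = subst_pow \<sigma> j u)"
proof -
  obtain K where K: "\<And>a n. bounded_letter \<sigma> a \<Longrightarrow> length (subst_pow \<sigma> n [a]) \<le> K"
    using bounded_letters_uniform[of \<sigma>] by blast
  \<comment> \<open>Growing letters get a dummy value, which keeps the range of \<open>F\<close> finite.\<close>
  define F where "F n = (\<lambda>a. if bounded_letter \<sigma> a then subst_pow \<sigma> n [a] else [])" for n
  have "finite {xs :: 'a list. length xs \<le> K}"
    using finite_lists_length_le[of "UNIV :: 'a set" K] by simp
  then have "finite (PiE UNIV (\<lambda>_::'a. {xs :: 'a list. length xs \<le> K}))"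
    by (intro finite_PiE) auto
  moreover have "range F \<subseteq> PiE UNIV (\<lambda>_::'a. {xs :: 'a list. length xs \<le> K})"
    using K by (auto simp: F_def)
  ultimately have "finite (range F)" by (rule rev_finite_subset)
  then have "\<not> inj F" using finite_imageD infinite_UNIV_nat by blast
  then obtain m n where "m \<noteq> n" "F m = F n" by (auto simp: inj_def)
  then obtain i j where ij: "i < j" "F j = F i" by (metis nat_neq_iff)
  define d where "d = j - i"
  have d: "d \<ge> 1" and F: "F (i + d) = F i" using ij by (auto simp: d_def)
  have base: "subst_pow \<sigma> (i + d) u = subst_pow \<sigma> i u" if "bounded_word \<sigma> u" for u
  proof -
    have "subst_pow \<sigma> (i + d) [a] = subst_pow \<sigma> i [a]" if "a \<in> set u" for a
      using fun_cong[OF F, of a] that \<open>bounded_word \<sigma> u\<close> by (simp add: F_def)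
    then show ?thesis
      using subst_pow_concat[of "i + d" \<sigma> u] subst_pow_concat[of i \<sigma> u]
      by (simp cong: map_cong)
  qed
  have step: "subst_pow \<sigma> (j + d) u = subst_pow \<sigma> j u" if "i \<le> j" "bounded_word \<sigma> u" for j u
  proof -
    have "j + d = (j - i) + (i + d)" "j = (j - i) + i" using that by auto
    then show ?thesis using base[OF that(2)] by (metis subst_pow_add)
  qed
  have "subst_pow \<sigma> (j + k * d) u = subst_pow \<sigma> j u" if "i \<le> j" "bounded_word \<sigma> u" for j k u
  proof (induction k)
    case (Suc k)
    then show ?case using step[of "j + k * d" u] that by (simp add: algebra_simps)
  qed simp
  with d show ?thesis by (intro exI[of _ i] exI[of _ d]) auto
qed


section \<open>Unbounded words of bounded letters force periodicity\<close>

lemma takeWhile_bounded_growing: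
  fixes \<sigma> :: "'a::finite \<Rightarrow> 'a list"
  assumes "substitution \<sigma>" "\<not> bounded_letter \<sigma> c" "bounded_word \<sigma> u"
  shows "takeWhile (bounded_letter \<sigma>) (subst_pow \<sigma> n (u @ c # v)) =
    subst_pow \<sigma> n u @ takeWhile (bounded_letter \<sigma>) (subst_pow \<sigma> n [c])"
proof -
  obtain b where b: "b \<in> set (subst_pow \<sigma> n [c])" "\<not> bounded_letter \<sigma> b"
    using assms bounded_letter_if_image_bounded by blast
  have "subst_pow \<sigma> n (u @ c # v) = subst_pow \<sigma> n u @ subst_pow \<sigma> n [c] @ subst_pow \<sigma> n v"
    by (simp add: subst_pow_append subst_pow_Cons[of n \<sigma> c v])
  moreover have "bounded_word \<sigma> (subst_pow \<sigma> n u)"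
    using bounded_word_subst_pow[OF assms(3)] .
  ultimately show ?thesis
    using takeWhile_append1[of b "subst_pow \<sigma> n [c]" "bounded_letter \<sigma>" "subst_pow \<sigma> n v"] b
    by (simp add: takeWhile_append2)
qed

text \<open>Write \<open>\<sigma>(c) = h(c) f(c) \<dots>\<close> with \<open>f(c)\<close> the first growing letter. The bounded head of
  \<open>\<sigma>\<^sup>n(c)\<close> is the concatenation of the words \<open>\<sigma>\<^bsup>n-1-i\<^esup>(h(f\<^sup>i(c)))\<close> for \<open>i < n\<close>. Each of these is short,
  so an unbounded head forces \<open>h(f\<^sup>i(c)) \<noteq> []\<close> for infinitely many \<open>i\<close>, and two of the letters
  \<open>f\<^sup>i(c)\<close> at such indices are equal.\<close>
lemma unbounded_heads_cycle:
  fixes \<sigma> :: "'a::finite \<Rightarrow> 'a list"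
  assumes sub: "substitution \<sigma>" and c: "\<not> bounded_letter \<sigma> c"
    and unb: "\<And>K. \<exists>n. K < length (takeWhile (bounded_letter \<sigma>) (subst_pow \<sigma> n [c]))"
  obtains c0 p v z where "p \<ge> 1" "v \<noteq> []" "bounded_word \<sigma> v"
    "subst_pow \<sigma> p [c0] = v @ c0 # z"
proof -
  obtain K where K: "\<And>a n. bounded_letter \<sigma> a \<Longrightarrow> length (subst_pow \<sigma> n [a]) \<le> K"
    using bounded_letters_uniform[of \<sigma>] by blast
  have "\<exists>h f z. \<sigma> c = h @ f # z \<and> bounded_word \<sigma> h \<and> \<not> bounded_letter \<sigma> f"
    if "\<not> bounded_letter \<sigma> c" for c
  proof -
    have "\<exists>b\<in>set (\<sigma> c). \<not> bounded_letter \<sigma> b"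
      using bounded_letter_if_image_bounded[OF sub, of 1 c] that by (auto simp: subst_ext_def)
    then obtain h f z where "\<sigma> c = h @ f # z" "\<not> bounded_letter \<sigma> f"
      "\<forall>b\<in>set h. \<not> \<not> bounded_letter \<sigma> b"
      by (rule split_list_first_propE)
    then show ?thesis by blast
  qed
  then obtain h f z where hf: "\<And>c. \<not> bounded_letter \<sigma> c \<Longrightarrow> \<sigma> c = h c @ f c # z c"
    and hb: "\<And>c. \<not> bounded_letter \<sigma> c \<Longrightarrow> bounded_word \<sigma> (h c)"
    and fg: "\<And>c. \<not> bounded_letter \<sigma> c \<Longrightarrow> \<not> bounded_letter \<sigma> (f c)"
    by metis
  have grow: "\<not> bounded_letter \<sigma> ((f ^^ i) c)" for i
    by (induction i) (use c fg in auto)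
  have head: "length (takeWhile (bounded_letter \<sigma>) (subst_pow \<sigma> n [c]))
      \<le> K * (\<Sum>i<n. length (h ((f ^^ i) c)))" if "\<not> bounded_letter \<sigma> c" for n c
    using that
  proof (induction n arbitrary: c)
    case (Suc n)
    have "takeWhile (bounded_letter \<sigma>) (subst_pow \<sigma> (Suc n) [c]) =
        subst_pow \<sigma> n (h c) @ takeWhile (bounded_letter \<sigma>) (subst_pow \<sigma> n [f c])"
      unfolding subst_pow_Suc_letter hf[OF Suc.prems]
      by (rule takeWhile_bounded_growing[OF sub fg[OF Suc.prems] hb[OF Suc.prems]])
    moreover have "length (subst_pow \<sigma> n (h c)) \<le> K * length (h c)"
      by (rule length_subst_pow_le) (use hb[OF Suc.prems] K in blast)
    moreover have "length (takeWhile (bounded_letter \<sigma>) (subst_pow \<sigma> n [f c]))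
        \<le> K * (\<Sum>i<n. length (h ((f ^^ i) (f c))))"
      by (rule Suc.IH[OF fg[OF Suc.prems]])
    moreover have "(\<Sum>i<Suc n. length (h ((f ^^ i) c))) =
        length (h c) + (\<Sum>i<n. length (h ((f ^^ i) (f c))))"
      by (simp add: sum.lessThan_Suc_shift funpow_Suc_right del: funpow.simps(2) sum.lessThan_Suc)
    ultimately show ?case by (simp add: algebra_simps)
  qed (use c in auto)
  define I where "I = {i. h ((f ^^ i) c) \<noteq> []}"
  have "infinite I"
  proof
    assume I: "finite I"
    have "(\<Sum>i<n. length (h ((f ^^ i) c))) \<le> (\<Sum>i\<in>I. length (h ((f ^^ i) c)))" for n
    proof -
      have "(\<Sum>i<n. length (h ((f ^^ i) c))) = (\<Sum>i\<in>{..<n} \<inter> I. length (h ((f ^^ i) c)))"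
        by (rule sum.mono_neutral_right) (auto simp: I_def)
      also have "\<dots> \<le> (\<Sum>i\<in>I. length (h ((f ^^ i) c)))"
        by (rule sum_mono2) (use I in auto)
      finally show ?thesis .
    qed
    then have "length (takeWhile (bounded_letter \<sigma>) (subst_pow \<sigma> n [c]))
        \<le> K * (\<Sum>i\<in>I. length (h ((f ^^ i) c)))" for n
      using head[OF c, of n] by (meson mult_le_mono2 order_trans)
    then show False using unb by (meson leD)
  qed
  then obtain i where i: "i \<in> I" "infinite {j\<in>I. (f ^^ j) c = (f ^^ i) c}"
    using pigeonhole_infinite[of I "\<lambda>i. (f ^^ i) c"] by auto
  then obtain j where j: "j > i" "(f ^^ j) c = (f ^^ i) c"
    unfolding infinite_nat_iff_unbounded by blast
  define c0 where "c0 = (f ^^ i) c"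
  define p where "p = j - i"
  have cyc: "(f ^^ p) c0 = c0"
  proof -
    have "j = p + i" using j by (simp add: p_def)
    then show ?thesis using j(2) by (simp add: c0_def funpow_add)
  qed
  have c0: "\<not> bounded_letter \<sigma> c0" "h c0 \<noteq> []" using grow i(1) by (auto simp: c0_def I_def)
  have orbit: "\<exists>v z. subst_pow \<sigma> n [e] = v @ (f ^^ n) e # z \<and> bounded_word \<sigma> v"
    if "\<not> bounded_letter \<sigma> e" for n e
    using that
  proof (induction n arbitrary: e)
    case 0
    have "subst_pow \<sigma> 0 [e] = [] @ (f ^^ 0) e # [] \<and> bounded_word \<sigma> []" by simp
    then show ?case by blast
  next
    case (Suc n)
    obtain v z' where v: "subst_pow \<sigma> n [f e] = v @ (f ^^ n) (f e) # z'" "bounded_word \<sigma> v"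
      using Suc.IH[OF fg[OF Suc.prems]] by blast
    have "subst_pow \<sigma> (Suc n) [e] = subst_pow \<sigma> n (h e) @ subst_pow \<sigma> n [f e] @ subst_pow \<sigma> n (z e)"
      unfolding subst_pow_Suc_letter hf[OF Suc.prems]
      by (simp add: subst_pow_append subst_pow_Cons[of n \<sigma> "f e" "z e"])
    then have "subst_pow \<sigma> (Suc n) [e] =
        (subst_pow \<sigma> n (h e) @ v) @ (f ^^ Suc n) e # (z' @ subst_pow \<sigma> n (z e))"
      using v(1) unfolding funpow_Suc_right by simp
    moreover have "bounded_word \<sigma> (subst_pow \<sigma> n (h e) @ v)"
      using bounded_word_subst_pow[OF hb[OF Suc.prems]] v(2) by auto
    ultimately show ?case by blast
  qed
  obtain q where p: "p = Suc q" using j by (cases p) (simp_all add: p_def)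
  obtain v z' where v: "subst_pow \<sigma> q [f c0] = v @ (f ^^ q) (f c0) # z'"
    "bounded_word \<sigma> v"
    using orbit[OF fg[OF c0(1)]] by blast
  have last: "(f ^^ q) (f c0) = c0"
    using cyc unfolding p funpow_Suc_right by simp
  have "subst_pow \<sigma> p [c0] = subst_pow \<sigma> q (\<sigma> c0)"
    unfolding p by (rule subst_pow_Suc_letter)
  also have "\<dots> = (subst_pow \<sigma> q (h c0) @ v) @ c0 # (z' @ subst_pow \<sigma> q (z c0))"
    unfolding hf[OF c0(1)] using v(1) last
    by (simp add: subst_pow_append subst_pow_Cons[of q \<sigma> "f c0" "z c0"])
  finally have eq: "subst_pow \<sigma> p [c0] = \<dots>" .
  have "subst_pow \<sigma> q (h c0) \<noteq> []"
    using length_le_subst_pow[OF sub, of "h c0" q] c0(2) by auto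
  moreover have "bounded_word \<sigma> (subst_pow \<sigma> q (h c0) @ v)"
    using bounded_word_subst_pow[OF hb[OF c0(1)]] v(2) by auto
  moreover have "p \<ge> 1" using p by simp
  ultimately show thesis using that eq by blast
qed

text \<open>Replacing \<open>p\<close> by a multiple of the period of \<open>\<sigma>\<close> on bounded words makes \<open>\<sigma>\<^sup>p\<close> fix its own late
  iterates of \<open>v\<close>. From then on each further application of \<open>\<sigma>\<^sup>p\<close> to \<open>c\<close> puts the same word \<open>w\<close> in front.\<close>
lemma cycle_powers_in_language:
  fixes \<sigma> :: "'a::finite \<Rightarrow> 'a list"
  assumes sub: "substitution \<sigma>" and p: "p \<ge> 1" and v: "v \<noteq> []" "bounded_word \<sigma> v"
    and cyc: "subst_pow \<sigma> p [c] = v @ c # z"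
  obtains w where "w \<noteq> []" "\<And>m. concat (replicate m w) \<in> subst_language \<sigma>"
proof -
  obtain i d where d: "d \<ge> 1"
    and per: "\<forall>j\<ge>i. \<forall>k u. bounded_word \<sigma> u \<longrightarrow> subst_pow \<sigma> (j + k * d) u = subst_pow \<sigma> j u"
    using subst_pow_eventually_periodic[of \<sigma>] by (elim exE conjE) (rule that)
  have "\<exists>v z. subst_pow \<sigma> (p * Suc k) [c] = v @ c # z \<and> v \<noteq> [] \<and> bounded_word \<sigma> v" for k
  proof (induction k)
    case 0
    then show ?case using v cyc by auto
  next
    case (Suc k)
    then obtain v' z' where v': "subst_pow \<sigma> (p * Suc k) [c] = v' @ c # z'" "v' \<noteq> []"
      "bounded_word \<sigma> v'" by blast
    have "subst_pow \<sigma> (p * Suc (Suc k)) [c] = subst_pow \<sigma> p (v' @ [c] @ z')"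
      unfolding mult_Suc_right[of p "Suc k"] subst_pow_add v'(1) by simp
    also have "\<dots> = (subst_pow \<sigma> p v' @ v) @ c # (z @ subst_pow \<sigma> p z')"
      unfolding subst_pow_append cyc by simp
    finally have "subst_pow \<sigma> (p * Suc (Suc k)) [c] = \<dots>" .
    moreover have "bounded_word \<sigma> (subst_pow \<sigma> p v' @ v)"
      using bounded_word_subst_pow[OF v'(3)] v(2) by auto
    ultimately show ?case using v(1) by blast
  qed
  moreover obtain k where "d = Suc k" using d by (cases d) auto
  ultimately obtain v' z' where
    v': "subst_pow \<sigma> (p * d) [c] = v' @ c # z'" "v' \<noteq> []" "bounded_word \<sigma> v'"
    by blast
  define q where "q = p * d"
  have q: "q \<ge> 1" using p d by (simp add: q_def)
  define w where "w = subst_pow \<sigma> (q * i) v'"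
  have w: "subst_pow \<sigma> (q * (i + m)) v' = w" for m
  proof -
    have "i \<le> q * i" using q by simp
    then have "subst_pow \<sigma> (q * i + (p * m) * d) v' = w"
      using per v'(3) unfolding w_def by simp
    moreover have "q * i + (p * m) * d = q * (i + m)" by (simp add: q_def algebra_simps)
    ultimately show ?thesis by simp
  qed
  have "w \<noteq> []"
    using length_le_subst_pow[OF sub, of v' "q * i"] v'(2) by (auto simp: w_def)
  have powers: "\<exists>r. subst_pow \<sigma> (q * (i + m)) [c] = concat (replicate m w) @ r" for m
  proof (induction m)
    case (Suc m)
    then obtain r where r: "subst_pow \<sigma> (q * (i + m)) [c] = concat (replicate m w) @ r"
      by blast
    have "subst_pow \<sigma> (q * (i + Suc m)) [c] = subst_pow \<sigma> (q * (i + m)) (v' @ [c] @ z')"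
    proof -
      have "q * (i + Suc m) = q * (i + m) + q" by simp
      then show ?thesis using v'(1) by (simp only: subst_pow_add q_def append_Cons append_Nil)
    qed
    also have "\<dots> = concat (replicate (Suc m) w) @ (r @ subst_pow \<sigma> (q * (i + m)) z')"
      unfolding subst_pow_append w r by simp
    finally show ?case by blast
  qed simp
  have "concat (replicate m w) \<in> subst_language \<sigma>" for m
  proof -
    obtain r where r: "subst_pow \<sigma> (q * (i + Suc m)) [c] = concat (replicate (Suc m) w) @ r"
      using powers[of "Suc m"] by blast
    then have "sublist (concat (replicate m w)) (subst_pow \<sigma> (q * (i + Suc m)) [c])"
      by (metis append.assoc concat.simps(2) replicate_Suc sublist_def)
    moreover have "q * (i + Suc m) \<ge> 1" using q by simp
    ultimately show ?thesis unfolding subst_language_def by blast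
  qed
  with \<open>w \<noteq> []\<close> show thesis using that by blast
qed

lemma bounded_prefixes_bounded_length:
  fixes \<sigma> :: "'a::finite \<Rightarrow> 'a list"
  assumes sub: "substitution \<sigma>"
    and free: "\<And>w. w \<noteq> [] \<Longrightarrow> \<exists>m. concat (replicate m w) \<notin> subst_language \<sigma>"
  obtains K where
    "\<And>n a w. \<lbrakk>prefix w (subst_pow \<sigma> n [a]); bounded_word \<sigma> w\<rbrakk> \<Longrightarrow> length w \<le> K"
proof -
  have "\<exists>K. \<forall>n. length (takeWhile (bounded_letter \<sigma>) (subst_pow \<sigma> n [a])) \<le> K" for a
  proof (cases "bounded_letter \<sigma> a")
    case True
    then show ?thesis unfolding bounded_letter_def
      by (meson length_takeWhile_le order_trans)
  next
    case False
    show ?thesis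
    proof (rule ccontr)
      assume "\<not> ?thesis"
      then have "\<exists>n. K < length (takeWhile (bounded_letter \<sigma>) (subst_pow \<sigma> n [a]))" for K
        by (meson linorder_not_le)
      from unbounded_heads_cycle[OF sub False this] obtain c p v z where
        "p \<ge> 1" "v \<noteq> []" "bounded_word \<sigma> v" "subst_pow \<sigma> p [c] = v @ c # z" by metis
      from cycle_powers_in_language[OF sub this] free show False by metis
    qed
  qed
  then obtain k where k: "\<And>a n. length (takeWhile (bounded_letter \<sigma>) (subst_pow \<sigma> n [a])) \<le> k a"
    by metis
  have "length w \<le> Max (range k)"
    if w: "prefix w (subst_pow \<sigma> n [a])" "bounded_word \<sigma> w" for n a w
  proof -
    obtain r where "subst_pow \<sigma> n [a] = w @ r" using w(1) by (rule prefixE)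
    then have "length w \<le> length (takeWhile (bounded_letter \<sigma>) (subst_pow \<sigma> n [a]))"
      using w(2) by (simp add: takeWhile_append2)
    also have "\<dots> \<le> k a" by (rule k)
    also have "\<dots> \<le> Max (range k)" by simp
    finally show ?thesis .
  qed
  then show thesis using that by blast
qed

text \<open>The substitution \<open>rev \<circ> \<sigma>\<close> is the mirror image of \<open>\<sigma>\<close>: it has the same bounded letters and the
  reversed language, so that statements about prefixes transfer to suffixes.\<close>
lemma subst_pow_rev: "subst_pow (rev \<circ> \<sigma>) n (rev w) = rev (subst_pow \<sigma> n w)"
proof (induction n)
  case (Suc n)
  have step: "subst_ext (rev \<circ> \<sigma>) (rev w) = rev (subst_ext \<sigma> w)" for w
    by (simp add: subst_ext_def rev_concat rev_map)
  have "subst_pow (rev \<circ> \<sigma>) (Suc n) (rev w) =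
      subst_ext (rev \<circ> \<sigma>) (subst_pow (rev \<circ> \<sigma>) n (rev w))"
    by simp
  also have "\<dots> = rev (subst_ext \<sigma> (subst_pow \<sigma> n w))"
    unfolding Suc by (rule step)
  also have "\<dots> = rev (subst_pow \<sigma> (Suc n) w)" by simp
  finally show ?case .
qed simp

lemma subst_pow_rev_letter: "subst_pow (rev \<circ> \<sigma>) n [a] = rev (subst_pow \<sigma> n [a])"
  using subst_pow_rev[where w = "[a]"] by simp

lemma bounded_suffixes_bounded_length:
  fixes \<sigma> :: "'a::finite \<Rightarrow> 'a list"
  assumes sub: "substitution \<sigma>"
    and free: "\<And>w. w \<noteq> [] \<Longrightarrow> \<exists>m. concat (replicate m w) \<notin> subst_language \<sigma>"
  obtains K where
    "\<And>n a w. \<lbrakk>suffix w (subst_pow \<sigma> n [a]); bounded_word \<sigma> w\<rbrakk> \<Longrightarrow> length w \<le> K"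
proof -
  have bd: "bounded_letter (rev \<circ> \<sigma>) = bounded_letter \<sigma>"
    by (simp add: fun_eq_iff bounded_letter_def subst_pow_rev_letter)
  have lang: "u \<in> subst_language (rev \<circ> \<sigma>) \<longleftrightarrow> rev u \<in> subst_language \<sigma>" for u
    by (simp add: subst_language_def subst_pow_rev_letter sublist_rev_right)
  have sub': "substitution (rev \<circ> \<sigma>)" using sub by (simp add: substitution_def)
  have "\<exists>m. concat (replicate m w) \<notin> subst_language (rev \<circ> \<sigma>)" if "w \<noteq> []" for w
    using free[of "rev w"] that by (simp add: lang rev_concat)
  from bounded_prefixes_bounded_length[OF sub' this] obtain K where
    K: "\<And>n a w. \<lbrakk>prefix w (subst_pow (rev \<circ> \<sigma>) n [a]); bounded_word (rev \<circ> \<sigma>) w\<rbrakk> \<Longrightarrow> length w \<le> K"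
    by blast
  have "length w \<le> K" if "suffix w (subst_pow \<sigma> n [a])" "bounded_word \<sigma> w" for n a w
    using K[of "rev w" n a] that by (simp add: bd subst_pow_rev_letter suffix_to_prefix)
  then show thesis using that by blast
qed

text \<open>A factor of a concatenation that lies in none of the pieces is composed of a suffix of one
  piece, some complete pieces, and a prefix of another piece.\<close>
lemma sublist_concat_short:
  assumes K: "\<And>v w. \<lbrakk>v \<in> set vs; prefix w v \<or> suffix w v; \<forall>a\<in>set w. P a\<rbrakk> \<Longrightarrow> length w \<le> K"
    and "sublist w (concat vs)" "\<forall>a\<in>set w. P a"
  shows "(\<exists>v\<in>set vs. sublist w v) \<or> length w \<le> K * length vs"
proof -
  have pre: "length w \<le> K * length vs"
    if "prefix w (concat vs)" "\<forall>a\<in>set w. P a"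
      "\<And>v w. \<lbrakk>v \<in> set vs; prefix w v \<or> suffix w v; \<forall>a\<in>set w. P a\<rbrakk> \<Longrightarrow> length w \<le> K" for w vs
    using that
  proof (induction vs arbitrary: w)
    case (Cons v vs)
    from Cons.prems(1) consider "prefix w v" | u where "w = v @ u" "prefix u (concat vs)"
      by (auto simp: prefix_append)
    then show ?case
    proof cases
      case 1
      then show ?thesis using Cons.prems(2) Cons.prems(3)[of v w] by simp
    next
      case 2
      then have "length v \<le> K" "length u \<le> K * length vs"
        using Cons.prems(2) Cons.prems(3)[of v v] Cons.IH[of u] Cons.prems(3) by auto
      then show ?thesis using 2 by simp
    qed
  qed simp
  show ?thesis
    using assms
  proof (induction vs)
    case (Cons v vs)
    from Cons.prems(2) consider "sublist w v" | "sublist w (concat vs)" |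
      s t where "w = s @ t" "suffix s v" "prefix t (concat vs)"
      by (auto simp: sublist_append)
    then show ?case
    proof cases
      case 2
      then have "(\<exists>v\<in>set vs. sublist w v) \<or> length w \<le> K * length vs"
        using Cons by (metis list.set_intros(2))
      then show ?thesis by auto
    next
      case 3
      then have "length s \<le> K" "length t \<le> K * length vs"
        using Cons.prems(3) Cons.prems(1)[of v s] pre[of t vs] Cons.prems(1) by auto
      then show ?thesis using 3(1) by simp
    qed simp
  qed simp
qed

text \<open>By induction on \<open>n\<close>: a bounded factor of \<open>\<sigma>\<^bsup>n+1\<^esup>(a)\<close> either lies in \<open>\<sigma>\<^sup>n(b)\<close> for a letter \<open>b\<close> of
  \<open>\<sigma>(a)\<close>, or consists of at most \<open>R\<close> bounded prefixes and suffixes of such words. The second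
  alternative gives a bound that does not depend on \<open>n\<close>, so nothing accumulates.\<close>
lemma bounded_words_bounded_length:
  fixes \<sigma> :: "'a::finite \<Rightarrow> 'a list"
  assumes sub: "substitution \<sigma>"
    and free: "\<And>w. w \<noteq> [] \<Longrightarrow> \<exists>m. concat (replicate m w) \<notin> subst_language \<sigma>"
  obtains L where "\<And>w n a. \<lbrakk>sublist w (subst_pow \<sigma> n [a]); bounded_word \<sigma> w\<rbrakk> \<Longrightarrow> length w \<le> L"
proof -
  obtain K1 where K1:
    "\<And>n a w. \<lbrakk>prefix w (subst_pow \<sigma> n [a]); bounded_word \<sigma> w\<rbrakk> \<Longrightarrow> length w \<le> K1"
    using bounded_prefixes_bounded_length[OF sub free] by blast
  obtain K2 where K2:
    "\<And>n a w. \<lbrakk>suffix w (subst_pow \<sigma> n [a]); bounded_word \<sigma> w\<rbrakk> \<Longrightarrow> length w \<le> K2"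
    using bounded_suffixes_bounded_length[OF sub free] by blast
  define K where "K = max K1 K2"
  define R where "R = Max (range (\<lambda>a. length (\<sigma> a)))"
  have R: "length (\<sigma> a) \<le> R" for a by (simp add: R_def)
  have "length w \<le> K * R + 1" if "sublist w (subst_pow \<sigma> n [a])" "bounded_word \<sigma> w" for w n a
    using that
  proof (induction n arbitrary: a)
    case 0
    then show ?case using sublist_length_le by fastforce
  next
    case (Suc n)
    let ?vs = "map (\<lambda>b. subst_pow \<sigma> n [b]) (\<sigma> a)"
    have "subst_pow \<sigma> (Suc n) [a] = concat ?vs"
      unfolding subst_pow_Suc_letter by (rule subst_pow_concat)
    moreover have "length u \<le> K"
      if "v \<in> set ?vs" "prefix u v \<or> suffix u v" "bounded_word \<sigma> u" for u v
      using that K1 K2 unfolding K_def by (fastforce simp: le_max_iff_disj)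
    ultimately have "(\<exists>v\<in>set ?vs. sublist w v) \<or> length w \<le> K * length ?vs"
      using sublist_concat_short[of ?vs "bounded_letter \<sigma>" K w] Suc.prems by metis
    then show ?case
    proof
      assume "\<exists>v\<in>set ?vs. sublist w v"
      then show ?thesis using Suc.IH Suc.prems(2) by auto
    next
      assume "length w \<le> K * length ?vs"
      also have "\<dots> \<le> K * R" using R by simp
      finally show ?thesis by simp
    qed
  qed
  then show thesis using that by blast
qed

lemma nth_concat_replicate:
  "k < m * length w \<Longrightarrow> concat (replicate m w) ! k = w ! (k mod length w)"
proof (induction m arbitrary: k)
  case (Suc m)
  then show ?case
    by (cases "k < length w") (auto simp: nth_append le_mod_geq)
qed simp

text \<open>If all powers of \<open>w\<close> lie in the language, then so do all windows of the point that repeats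
  \<open>w\<close> in both directions.\<close>
lemma aperiodic_power_not_in_language:
  assumes "aperiodic \<sigma>" "w \<noteq> []"
  shows "\<exists>m. concat (replicate m w) \<notin> subst_language \<sigma>"
proof (rule ccontr)
  assume "\<not> ?thesis"
  then have pow: "concat (replicate m w) \<in> subst_language \<sigma>" for m by blast
  define l where "l = length w"
  have l: "l \<ge> 1" using assms(2) by (simp add: l_def Suc_leI)
  define x where "x i = w ! nat (i mod int l)" for i :: int
  have "map x [- int n..int n] \<in> subst_language \<sigma>" for n :: nat
  proof -
    define W where "W = concat (replicate (2 * n + 2) w)"
    \<comment> \<open>The window starts at position \<open>r\<close> inside a copy of \<open>w\<close>; one more copy than the
      window could need makes up for this offset.\<close>
    define r where "r = nat ((- int n) mod int l)"
    have r: "r < l" "int r = (- int n) mod int l" using l by (auto simp: r_def nat_less_iff)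
    have len: "length W = (2 * n + 2) * l" unfolding W_def length_concat map_replicate sum_list_replicate l_def by simp
    have "2 * n + 1 \<le> (2 * n + 1) * l" using mult_le_mono2[OF l, of "2 * n + 1"] by simp
    then have "r + (2 * n + 1) \<le> l + (2 * n + 1) * l" using r(1) by linarith
    then have le: "r + (2 * n + 1) \<le> (2 * n + 2) * l" by (simp add: algebra_simps)
    have "map x [- int n..int n] = take (2 * n + 1) (drop r W)"
    proof (rule nth_equalityI)
      show "length (map x [- int n..int n]) = length (take (2 * n + 1) (drop r W))"
        using le len by simp
      fix k assume "k < length (map x [- int n..int n])"
      then have k: "k < 2 * n + 1" by simp
      then have "map x [- int n..int n] ! k = x (- int n + int k)"
        by (simp add: nth_upto)
      also have "\<dots> = w ! ((r + k) mod l)"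
      proof -
        have "(- int n + int k) mod int l = int ((r + k) mod l)"
          by (simp add: of_nat_mod r(2) mod_add_left_eq)
        then show ?thesis by (simp add: x_def)
      qed
      also have "\<dots> = take (2 * n + 1) (drop r W) ! k"
        using nth_concat_replicate[of "r + k" "2 * n + 2" w, folded W_def l_def] k le len by simp
      finally show "map x [- int n..int n] ! k = take (2 * n + 1) (drop r W) ! k" .
    qed
    moreover have "sublist (take (2 * n + 1) (drop r W)) W"
      using sublist_order.order.trans sublist_take sublist_drop by blast
    ultimately show ?thesis using subst_language_sublist[OF pow] unfolding W_def by metis
  qed
  then have "x \<in> subst_space \<sigma>" by (simp add: subst_space_def)
  moreover have "(left_shift ^^ p) y = (\<lambda>i. y (i + int p))" for p and y :: "int \<Rightarrow> 'a"
    by (induction p) (simp_all add: left_shift_def algebra_simps)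
  then have "(left_shift ^^ l) x = x" by (simp add: fun_eq_iff x_def)
  ultimately show False using assms(1) l unfolding aperiodic_def by blast
qed


section \<open>Images of growing letters in points of the system\<close>

definition occurs :: "'a list \<Rightarrow> (int \<Rightarrow> 'a) \<Rightarrow> bool" where
  "occurs w x \<longleftrightarrow> (\<exists>i. \<forall>k<length w. x (i + int k) = w ! k)"

lemma occurs_sublist:
  assumes "occurs w x" "sublist v w"
  shows "occurs v x"
proof -
  obtain p q where w: "w = p @ v @ q" using assms(2) by (auto simp: sublist_def)
  obtain i where i: "\<And>k. k < length w \<Longrightarrow> x (i + int k) = w ! k"
    using assms(1) by (auto simp: occurs_def)
  have "x ((i + int (length p)) + int k) = v ! k" if "k < length v" for k
    using i[of "length p + k"] that by (simp add: w nth_append algebra_simps)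
  then show ?thesis unfolding occurs_def by blast
qed

lemma occurs_window: "occurs (map x [- int n..int n]) x"
  unfolding occurs_def by (rule exI[of _ "- int n"]) (simp add: nth_upto)

text \<open>Desubstitution: a factor of the image of \<open>u\<close> is the image of a factor of \<open>u\<close>, apart from the
  two letters of \<open>u\<close> whose images are cut by its ends.\<close>
lemma sublist_concat_map_cover:
  assumes "\<And>a. length (g a) \<le> G" "sublist w (concat (map g u))"
  obtains s v t where "w = s @ concat (map g v) @ t" "sublist v u" "length s \<le> G" "length t \<le> G"
proof -
  have pre: "\<exists>v t. w = concat (map g v) @ t \<and> prefix v u \<and> length t \<le> G"
    if "prefix w (concat (map g u))" for w u
    using that
  proof (induction u arbitrary: w)
    case (Cons a u)
    from Cons.prems consider "prefix w (g a)" | r where "w = g a @ r" "prefix r (concat (map g u))"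
      by (auto simp: prefix_append)
    then show ?case
    proof cases
      case 1
      then have "length w \<le> G" using assms(1)[of a] prefix_length_le order_trans by blast
      then have "w = concat (map g []) @ w \<and> prefix [] (a # u) \<and> length w \<le> G" by simp
      then show ?thesis by blast
    next
      case 2
      then obtain v t where "r = concat (map g v) @ t" "prefix v u" "length t \<le> G"
        using Cons.IH by blast
      then have "w = concat (map g (a # v)) @ t \<and> prefix (a # v) (a # u) \<and> length t \<le> G"
        using 2 by simp
      then show ?thesis by blast
    qed
  qed simp
  have "\<exists>s v t. w = s @ concat (map g v) @ t \<and> sublist v u \<and> length s \<le> G \<and> length t \<le> G"
    using assms(2)
  proof (induction u)
    case (Cons a u)
    from Cons.prems consider "sublist w (g a)" | "sublist w (concat (map g u))" |
      s r where "w = s @ r" "suffix s (g a)" "prefix r (concat (map g u))"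
      by (auto simp: sublist_append)
    then show ?case
    proof cases
      case 1
      then have "length w \<le> G" using assms(1)[of a] sublist_length_le order_trans by blast
      then have "w = w @ concat (map g []) @ [] \<and> sublist [] (a # u) \<and> length w \<le> G
          \<and> length ([] :: 'b list) \<le> G" by simp
      then show ?thesis by blast
    next
      case 2
      then show ?thesis using Cons.IH by (meson sublist_Cons_right)
    next
      case 3
      then obtain v t where v: "r = concat (map g v) @ t" "prefix v u" "length t \<le> G"
        using pre by blast
      have "length s \<le> G" using 3(2) assms(1)[of a] suffix_length_le order_trans by blast
      moreover have "sublist v (a # u)"
        using v(2) by (meson prefix_imp_sublist sublist_Cons_right)
      ultimately show ?thesis using 3(1) v by blast
    qed
  qed simp
  then show thesis using that by blast
qed

lemma growing_letter_image_occurs: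
  fixes \<sigma> :: "'a::finite \<Rightarrow> 'a list"
  assumes sub: "substitution \<sigma>" and ap: "aperiodic \<sigma>" and x: "x \<in> subst_space \<sigma>"
  obtains c where "\<not> bounded_letter \<sigma> c" "occurs (subst_pow \<sigma> n [c]) x"
proof -
  obtain L where L: "\<And>w m a. \<lbrakk>sublist w (subst_pow \<sigma> m [a]); bounded_word \<sigma> w\<rbrakk> \<Longrightarrow> length w \<le> L"
    using bounded_words_bounded_length[OF sub aperiodic_power_not_in_language[OF ap]] by blast
  define G where "G = Max (range (\<lambda>a. length (subst_pow \<sigma> n [a])))"
  have G: "length (subst_pow \<sigma> n [a]) \<le> G" for a by (simp add: G_def)
  \<comment> \<open>Two incomplete images at the ends, and the image of a word of at most \<open>L\<close> letters.\<close>
  define N where "N = G + G * L + G"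
  define w where "w = map x [- int N..int N]"
  have lw: "length w = 2 * N + 1" by (simp add: w_def)
  have "w \<in> subst_language \<sigma>" using x by (simp add: w_def subst_space_def)
  then obtain a m where am: "sublist w (subst_pow \<sigma> m [a])"
    unfolding subst_language_def by blast
  \<comment> \<open>The window is too long for an iterate of order below \<open>n\<close>, so \<open>\<sigma>\<^sup>n\<close> can be split off.\<close>
  have "n \<le> m"
  proof (rule ccontr)
    assume "\<not> n \<le> m"
    then have "length (subst_pow \<sigma> m [a]) \<le> G"
      using length_subst_pow_mono[OF sub, of m n "[a]"] G[of a] by simp
    then show False using sublist_length_le[OF am] lw by (simp add: N_def)
  qed
  then have "subst_pow \<sigma> m [a] = subst_pow \<sigma> n (subst_pow \<sigma> (m - n) [a])"
    using subst_pow_add[of n "m - n" \<sigma> "[a]"] by simp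
  also have "\<dots> = concat (map (\<lambda>b. subst_pow \<sigma> n [b]) (subst_pow \<sigma> (m - n) [a]))"
    by (rule subst_pow_concat)
  finally have "sublist w (concat (map (\<lambda>b. subst_pow \<sigma> n [b]) (subst_pow \<sigma> (m - n) [a])))"
    using am by simp
  then obtain s v t where v: "w = s @ concat (map (\<lambda>b. subst_pow \<sigma> n [b]) v) @ t"
    "sublist v (subst_pow \<sigma> (m - n) [a])" "length s \<le> G" "length t \<le> G"
    using sublist_concat_map_cover[of "\<lambda>b. subst_pow \<sigma> n [b]" G, OF G] by blast
  have w: "w = s @ subst_pow \<sigma> n v @ t" using v(1) subst_pow_concat[of n \<sigma> v] by simp
  have "\<not> bounded_word \<sigma> v"
  proof
    assume "bounded_word \<sigma> v"
    then have "length v \<le> L" using L v(2) by blast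
    moreover have "length (subst_pow \<sigma> n v) \<le> G * length v"
      by (rule length_subst_pow_le) (rule G)
    ultimately have "length (subst_pow \<sigma> n v) \<le> G * L"
      by (meson mult_le_mono2 order_trans)
    then have "length w \<le> N" using v(3,4) by (simp add: w N_def)
    then show False using lw by simp
  qed
  then obtain c where c: "c \<in> set v" "\<not> bounded_letter \<sigma> c" by blast
  have "sublist (subst_pow \<sigma> n v) w" by (auto simp: w sublist_def)
  then have "sublist (subst_pow \<sigma> n [c]) w"
    using sublist_subst_pow_letter[OF c(1)] sublist_order.order.trans by blast
  then have "occurs (subst_pow \<sigma> n [c]) x"
    using occurs_sublist[OF occurs_window] unfolding w_def by blast
  with c(2) show thesis using that by blast
qed


section \<open>Minimal components with common long words\<close>

lemma topspace_full_shift [simp]: "topspace full_shift_topology = UNIV"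
  by (simp add: full_shift_topology_def)

lemma compact_full_shift:
  "compact_space (full_shift_topology :: (int \<Rightarrow> 'a::finite) topology)"
  by (simp add: full_shift_topology_def compact_space_product_topology compact_space_discrete_topology)

lemma openin_finite_coordinates:
  assumes "finite J" "\<And>x y. \<lbrakk>x \<in> U; \<And>j. j \<in> J \<Longrightarrow> x j = y j\<rbrakk> \<Longrightarrow> y \<in> U"
  shows "openin full_shift_topology U"
proof (subst openin_subopen, intro ballI)
  fix x assume x: "x \<in> U"
  define C where "C = PiE UNIV (\<lambda>j. if j \<in> J then {x j} else UNIV)"
  have "openin full_shift_topology C"
    unfolding full_shift_topology_def C_def
  proof (rule product_topology_basis)
    show "finite {j. (if j \<in> J then {x j} else UNIV) \<noteq> topspace (discrete_topology UNIV)}"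
      by (rule finite_subset[OF _ assms(1)]) auto
  qed simp
  moreover have "x \<in> C" by (auto simp: C_def)
  moreover have "C \<subseteq> U"
  proof
    fix y assume y: "y \<in> C"
    have "x j = y j" if "j \<in> J" for j
      using y that PiE_mem[of y UNIV "\<lambda>j. if j \<in> J then {x j} else UNIV" j] by (simp add: C_def)
    then show "y \<in> U" using assms(2) x by blast
  qed
  ultimately show "\<exists>T. openin full_shift_topology T \<and> x \<in> T \<and> T \<subseteq> U" by blast
qed

lemma closedin_finite_coordinates:
  assumes "finite J" "\<And>x y. \<lbrakk>x \<in> U; \<And>j. j \<in> J \<Longrightarrow> x j = y j\<rbrakk> \<Longrightarrow> y \<in> U"
  shows "closedin full_shift_topology U"
proof -
  have "openin full_shift_topology (UNIV - U)"
  proof (rule openin_finite_coordinates[OF assms(1)])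
    fix x y assume "x \<in> UNIV - U" "\<And>j. j \<in> J \<Longrightarrow> x j = y j"
    then show "y \<in> UNIV - U" using assms(2)[of y x] by auto
  qed
  then show ?thesis by (simp add: closedin_def)
qed

lemma closedin_subst_space: "closedin full_shift_topology (subst_space \<sigma>)"
proof -
  have "closedin full_shift_topology {x. map x [- int n..int n] \<in> subst_language \<sigma>}" for n
  proof (rule closedin_finite_coordinates[of "{- int n..int n}"])
    fix x y :: "int \<Rightarrow> 'a"
    assume x: "x \<in> {x. map x [- int n..int n] \<in> subst_language \<sigma>}"
      and "\<And>j. j \<in> {- int n..int n} \<Longrightarrow> x j = y j"
    then have "map x [- int n..int n] = map y [- int n..int n]" by (intro map_cong) auto
    with x show "y \<in> {x. map x [- int n..int n] \<in> subst_language \<sigma>}" by simp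
  qed simp
  moreover have "subst_space \<sigma> = (\<Inter>n::nat. {x. map x [- int n..int n] \<in> subst_language \<sigma>})"
    by (auto simp: subst_space_def)
  ultimately show ?thesis by auto
qed

lemma minimal_component_closed:
  assumes "minimal_component \<sigma> M"
  shows "closedin full_shift_topology M"
proof -
  have "closedin (subtopology full_shift_topology (subst_space \<sigma>)) M"
    using assms by (simp add: minimal_component_def subst_topology_def)
  then show ?thesis by (rule closedin_trans_full[OF _ closedin_subst_space])
qed

lemma minimal_component_subset:
  assumes "minimal_component \<sigma> M"
  shows "M \<subseteq> subst_space \<sigma>"
  using assms closedin_subset[of "subst_topology \<sigma>" M]
  unfolding minimal_component_def subst_topology_def by auto

lemma minimal_component_shift:
  assumes "minimal_component \<sigma> M" "x \<in> M"
  shows "(\<lambda>i. x (i + k)) \<in> M"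
proof -
  have M: "left_shift ` M = M" using assms(1) by (simp add: minimal_component_def)
  have fwd: "(\<lambda>i. y (i + int n)) \<in> M" if "y \<in> M" for y n
  proof (induction n)
    case (Suc n)
    then have "left_shift (\<lambda>i. y (i + int n)) \<in> left_shift ` M" by (rule imageI)
    then have "left_shift (\<lambda>i. y (i + int n)) \<in> M" unfolding M .
    then show ?case by (simp add: left_shift_def algebra_simps)
  qed (use that in simp)
  have bwd: "(\<lambda>i. y (i - int n)) \<in> M" if "y \<in> M" for y n
  proof (induction n)
    case (Suc n)
    then have "(\<lambda>i. y (i - int n)) \<in> left_shift ` M" unfolding M .
    then obtain z where z: "z \<in> M" "left_shift z = (\<lambda>i. y (i - int n))" by auto
    have "z j = y (j - int (Suc n))" for j
      using fun_cong[OF z(2), of "j - 1"] by (simp add: left_shift_def algebra_simps)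
    then have "z = (\<lambda>j. y (j - int (Suc n)))" by (rule ext)
    with z(1) show ?case by simp
  qed (use that in simp)
  show ?thesis
  proof (cases "k \<ge> 0")
    case True
    then show ?thesis using fwd[OF assms(2), of "nat k"] by simp
  next
    case False
    then show ?thesis using bwd[OF assms(2), of "nat (- k)"] by simp
  qed
qed

text \<open>Each component is the orbit closure of any of its points, in particular of a common one.\<close>
lemma minimal_components_disjoint:
  assumes M: "minimal_component \<sigma> M" and N: "minimal_component \<sigma> N" and z: "z \<in> M" "z \<in> N"
  shows "M = N"
proof -
  have sub: "M \<subseteq> N" if M: "minimal_component \<sigma> M" and N: "minimal_component \<sigma> N"
    and z: "z \<in> M" "z \<in> N" for M N
  proof -
    have "M = subtopology (subst_topology \<sigma>) M closure_of shift_orbit z"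
      using M z(1) by (simp add: minimal_component_def)
    also have "\<dots> \<subseteq> subst_topology \<sigma> closure_of shift_orbit z"
      by (rule closure_of_subtopology_subset)
    also have "\<dots> \<subseteq> N"
    proof (rule closure_of_minimal)
      show "shift_orbit z \<subseteq> N"
        using minimal_component_shift[OF N z(2)] by (auto simp: shift_orbit_def)
      show "closedin (subst_topology \<sigma>) N" using N by (simp add: minimal_component_def)
    qed
    finally show ?thesis .
  qed
  show ?thesis using sub[OF M N z] sub[OF N M z(2,1)] by blast
qed

text \<open>The points of \<open>M\<close> that agree with some point of \<open>N\<close> on \<open>[-m, m]\<close> form a decreasing sequence of
  nonempty closed sets, because the defining condition depends on finitely many coordinates. A
  point in all of them can be approximated by points of \<open>N\<close>, and so belongs to \<open>N\<close>.\<close>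
lemma agreeing_closed_sets_meet:
  fixes M N :: "(int \<Rightarrow> 'a::finite) set"
  assumes M: "closedin full_shift_topology M" and N: "closedin full_shift_topology N"
    and agree: "\<And>m::nat. \<exists>x\<in>M. \<exists>y\<in>N. \<forall>j\<in>{- int m..int m}. x j = y j"
  obtains z where "z \<in> M" "z \<in> N"
proof -
  define C where "C m = {x. \<exists>y\<in>N. \<forall>j\<in>{- int m..int m}. x j = y j}" for m :: nat
  have "closedin full_shift_topology (C m)" for m
  proof (rule closedin_finite_coordinates[of "{- int m..int m}"])
    fix x x' assume "x \<in> C m" and eq: "\<And>j. j \<in> {- int m..int m} \<Longrightarrow> x j = x' j"
    then obtain y where "y \<in> N" "\<forall>j\<in>{- int m..int m}. x j = y j" by (auto simp: C_def)
    with eq show "x' \<in> C m" unfolding C_def by (intro CollectI bexI[of _ y]) auto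
  qed simp
  then have cl: "closedin full_shift_topology (M \<inter> C m)" for m using M by blast
  have ne: "M \<inter> C m \<noteq> {}" for m using agree[of m] by (auto simp: C_def)
  have anti: "C n \<subseteq> C m" if "m \<le> n" for m n
  proof
    fix x assume "x \<in> C n"
    then obtain y where "y \<in> N" "\<forall>j\<in>{- int n..int n}. x j = y j" by (auto simp: C_def)
    with that show "x \<in> C m" unfolding C_def by (intro CollectI bexI[of _ y]) auto
  qed
  have "(\<Inter>m. M \<inter> C m) \<noteq> {}"
  proof (rule compact_space_imp_nest[OF compact_full_shift cl ne])
    show "antimono (\<lambda>m. M \<inter> C m)" using anti by (auto simp: antimono_def)
  qed
  then obtain z where z: "z \<in> M" "\<And>m. z \<in> C m" by auto
  have "z \<in> N"
  proof (rule ccontr)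
    assume "z \<notin> N"
    have "openin full_shift_topology (UNIV - N)" using N by (simp add: closedin_def)
    from this[unfolded full_shift_topology_def openin_product_topology_alt] \<open>z \<notin> N\<close>
    have "\<exists>U. finite {i \<in> UNIV. U i \<noteq> topspace (discrete_topology UNIV)} \<and>
        z \<in> PiE UNIV U \<and> PiE UNIV U \<subseteq> UNIV - N"
      by blast
    then obtain U where U: "finite {i. U i \<noteq> UNIV}" "z \<in> PiE UNIV U" "PiE UNIV U \<subseteq> UNIV - N"
      by auto
    define m where "m = nat (Max (insert 0 (abs ` {i. U i \<noteq> UNIV})))"
    have m: "\<bar>j\<bar> \<le> int m" if "U j \<noteq> UNIV" for j
    proof -
      have "\<bar>j\<bar> \<le> Max (insert 0 (abs ` {i. U i \<noteq> UNIV}))"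
        using U(1) that by (intro Max_ge) auto
      also have "\<dots> \<le> int m" unfolding m_def by linarith
      finally show ?thesis .
    qed
    obtain y where y: "y \<in> N" "\<And>j. j \<in> {- int m..int m} \<Longrightarrow> z j = y j"
      using z(2)[of m] by (auto simp: C_def)
    have "y j \<in> U j" for j
    proof (cases "U j = UNIV")
      case False
      then have "j \<in> {- int m..int m}" using m[of j] by (simp add: abs_le_iff)
      then have "z j = y j" by (rule y(2))
      then show ?thesis using U(2) by (metis PiE_mem UNIV_I)
    qed simp
    then have "y \<in> PiE UNIV U" by auto
    then show False using U(3) y(1) by blast
  qed
  with z(1) show thesis using that by blast
qed

text \<open>Shifting the two points so that a common word becomes centred at the origin produces points of
  the two components that agree on a long central window.\<close>
lemma minimal_components_common_words:
  fixes \<sigma> :: "'a::finite \<Rightarrow> 'a list"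
  assumes M: "minimal_component \<sigma> M" and N: "minimal_component \<sigma> N"
    and x: "x \<in> M" and y: "y \<in> N"
    and common: "\<And>l. \<exists>w. l \<le> length w \<and> occurs w x \<and> occurs w y"
  shows "M = N"
proof -
  have "\<exists>x'\<in>M. \<exists>y'\<in>N. \<forall>j\<in>{- int m..int m}. x' j = y' j" for m
  proof -
    obtain w where w: "2 * m + 1 \<le> length w" "occurs w x" "occurs w y"
      using common by blast
    obtain p q where p: "\<And>k. k < length w \<Longrightarrow> x (p + int k) = w ! k"
      and q: "\<And>k. k < length w \<Longrightarrow> y (q + int k) = w ! k"
      using w(2,3) unfolding occurs_def by blast
    have "x (j + (p + int m)) = y (j + (q + int m))" if "j \<in> {- int m..int m}" for j
    proof -
      have "nat (j + int m) < length w" "int (nat (j + int m)) = j + int m"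
        using that w(1) by auto
      then show ?thesis using p[of "nat (j + int m)"] q[of "nat (j + int m)"]
        by (simp add: algebra_simps)
    qed
    then show ?thesis
      using minimal_component_shift[OF M x, of "p + int m"]
        minimal_component_shift[OF N y, of "q + int m"]
      by (intro bexI[of _ "\<lambda>i. x (i + (p + int m))"] bexI[of _ "\<lambda>i. y (i + (q + int m))"]) auto
  qed
  from agreeing_closed_sets_meet[OF minimal_component_closed[OF M] minimal_component_closed[OF N] this]
  obtain z where "z \<in> M" "z \<in> N" by blast
  then show ?thesis by (rule minimal_components_disjoint[OF M N])
qed


section \<open>Counting minimal components\<close>

text \<open>Finite subfamilies are counted first: they admit a single length \<open>m\<close> beyond which no two of
  the chosen points have a common word.\<close>
lemma card_minimal_components_le:
  fixes \<sigma> :: "'a::finite \<Rightarrow> 'a list"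
  assumes sub: "substitution \<sigma>" and ap: "aperiodic \<sigma>"
    and S: "finite S" "\<And>M. M \<in> S \<Longrightarrow> minimal_component \<sigma> M"
  shows "card S \<le> CARD('a)"
proof -
  have "\<exists>x. x \<in> M" if "M \<in> S" for M using S(2)[OF that] by (auto simp: minimal_component_def)
  then obtain pt where pt: "\<And>M. M \<in> S \<Longrightarrow> pt M \<in> M" by metis
  have "\<exists>l. \<forall>w. occurs w (pt M) \<and> occurs w (pt N) \<longrightarrow> length w < l"
    if "M \<in> S" "N \<in> S" "M \<noteq> N" for M N
    using minimal_components_common_words[OF S(2) S(2) pt pt, OF that(1,2,1,2)] that(3)
    by (meson linorder_not_less)
  then obtain l where l: "\<And>M N w. \<lbrakk>M \<in> S; N \<in> S; M \<noteq> N; occurs w (pt M); occurs w (pt N)\<rbrakk>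
      \<Longrightarrow> length w < l M N"
    by metis
  define m where "m = Max (case_prod l ` (S \<times> S))"
  have m: "l M N \<le> m" if "M \<in> S" "N \<in> S" for M N
    unfolding m_def using that S(1) by (intro Max_ge) auto
  obtain n where n: "\<And>c. \<not> bounded_letter \<sigma> c \<Longrightarrow> m \<le> length (subst_pow \<sigma> n [c])"
    using growing_letters_long[OF sub] by blast
  have "\<exists>c. \<not> bounded_letter \<sigma> c \<and> occurs (subst_pow \<sigma> n [c]) (pt M)" if "M \<in> S" for M
    using growing_letter_image_occurs[OF sub ap, of "pt M" n] pt[OF that]
      minimal_component_subset[OF S(2)[OF that]] by blast
  then obtain c where c: "\<And>M. M \<in> S \<Longrightarrow> \<not> bounded_letter \<sigma> (c M)"
    "\<And>M. M \<in> S \<Longrightarrow> occurs (subst_pow \<sigma> n [c M]) (pt M)"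
    by metis
  have "inj_on c S"
  proof (rule inj_onI, rule ccontr)
    fix M N assume MN: "M \<in> S" "N \<in> S" "c M = c N" "M \<noteq> N"
    then have "length (subst_pow \<sigma> n [c M]) < l M N"
      using l c(2)[of M] c(2)[of N] by metis
    then show False using m[OF MN(1,2)] n[OF c(1)[OF MN(1)]] by simp
  qed
  then show ?thesis using card_inj_on_le[of c S UNIV] by simp
qed

theorem proposition5p6:
  fixes \<sigma> :: "'a::finite \<Rightarrow> 'a list"
  assumes "substitution \<sigma>"
    and "aperiodic \<sigma>"
    and "uncountable (subst_space \<sigma>)"
  shows "finite {M. minimal_component \<sigma> M} \<and> card {M. minimal_component \<sigma> M} \<le> CARD('a)"
proof
  show fin: "finite {M. minimal_component \<sigma> M}"
  proof (rule ccontr)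
    assume "infinite {M. minimal_component \<sigma> M}"
    then obtain S where "S \<subseteq> {M. minimal_component \<sigma> M}" "finite S" "card S = Suc CARD('a)"
      using infinite_arbitrarily_large by blast
    then show False using card_minimal_components_le[OF assms(1,2), of S] by auto
  qed
  show "card {M. minimal_component \<sigma> M} \<le> CARD('a)"
    by (rule card_minimal_components_le[OF assms(1,2) fin]) simp
qed

end
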